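(* Let $\mathbb{K}$ be a field with $\operatorname{char}(\mathbb{K})\neq 2$, let $V=\mathbb{K}^4$ with standard basis $e_1,\dots,e_4$, and let $$\det\nolimits_4=\sum_{\sigma\in\mathfrak{S}_4}\operatorname{sgn}(\sigma)\,e_{\sigma(1)}\otimes e_{\sigma(2)}\otimes e_{\sigma(3)}\otimes e_{\sigma(4)}\in V^{\otimes 4}.$$ Then the tensor rank of $\det_4$ over $\mathbb{K}$ is $\mathbf{R}(\det_4)=12$.
   Context: $\mathfrak{S}_4$ is the symmetric group on $4$ letters. For finite-dimensional $\mathbb{K}$-vector spaces $V_1,\dots,V_d$ and $T\in V_1\otimes\cdots\otimes V_d$, the tensor rank $\mathbf{R}(T)$ is the minimal $k$ such that $T=\sum_{i=1}^k v_{i,1}\otimes\cdots\otimes v_{i,d}$ with $v_{i,j}\in V_j$. *)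

theory Defs
  imports "HOL-Analysis.Analysis"
begin

text \<open>
  For \<open>V = K^n\<close>, the tensor power \<open>V \<otimes> \<dots> \<otimes> V\<close> with factors indexed by the finite type \<open>'d\<close> is
  realised in coordinates: a tensor is a family of scalars indexed by the multi-indices
  \<open>'d \<Rightarrow> 'n\<close>. The lemma \<open>pure_tensor_universal\<close> below shows that this, together with
  \<open>pure_tensor\<close>, has the universal property of the tensor product.
\<close>

type_synonym ('a, 'd, 'n) tensor = "'a ^ ('d \<Rightarrow> 'n)"

definition pure_tensor :: "('d \<Rightarrow> 'a ^ 'n) \<Rightarrow> ('a::field, 'd::finite, 'n::finite) tensor" where
  "pure_tensor v = (\<chi> idx. \<Prod>j\<in>UNIV. v j $ idx j)"

definition tensor_rank :: "('a::field, 'd::finite, 'n::finite) tensor \<Rightarrow> nat" where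
  "tensor_rank T =
     (LEAST k. \<exists>v :: nat \<Rightarrow> 'd \<Rightarrow> 'a ^ 'n. T = (\<Sum>i<k. pure_tensor (v i)))"

text \<open>
  The factors and the standard basis vectors \<open>axis i 1\<close> of \<open>V\<close> are indexed by the same type \<open>'n\<close>,
  so that a permutation \<open>\<sigma>\<close> of \<open>'n\<close> puts \<open>e\<^bsub>\<sigma>(i)\<^esub>\<close> in position \<open>i\<close>.
\<close>

definition det_tensor :: "('a::field, 'n, 'n::finite) tensor" where
  "det_tensor =
     (\<Sum>\<sigma> | \<sigma> permutes (UNIV :: 'n set).
        of_int (sign \<sigma>) *s pure_tensor (\<lambda>i. axis (\<sigma> i) 1))"

definition multilinear ::
  "('a::field \<Rightarrow> 'b::ab_group_add \<Rightarrow> 'b) \<Rightarrow> (('d \<Rightarrow> 'a ^ 'n) \<Rightarrow> 'b) \<Rightarrow> bool" where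
  "multilinear scl f \<longleftrightarrow> (\<forall>v j. Vector_Spaces.linear (*s) scl (\<lambda>x. f (v(j := x))))"

lemma pure_tensor_axis:
  fixes idx :: "'d::finite \<Rightarrow> 'n::finite"
  shows "pure_tensor (\<lambda>j. axis (idx j) 1) = axis idx (1 :: 'a::field)"
proof (subst vec_eq_iff, rule allI)
  fix idx' :: "'d \<Rightarrow> 'n"
  show "pure_tensor (\<lambda>j. axis (idx j) (1::'a)) $ idx' = axis idx 1 $ idx'"
    by (cases "idx = idx'") (auto simp: pure_tensor_def axis_def prod_zero_iff fun_eq_iff)
qed

lemma multilinear_pure_tensor:
  "multilinear (*s) (pure_tensor :: ('d \<Rightarrow> 'a ^ 'n) \<Rightarrow> ('a::field, 'd::finite, 'n::finite) tensor)"
proof -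
  have "(\<Prod>i\<in>UNIV. (v(j := x)) i $ idx i) = x $ idx j * (\<Prod>i\<in>UNIV - {j}. v i $ idx i)"
    for v :: "'d \<Rightarrow> 'a ^ 'n" and j x idx
    by (subst prod.remove[of _ j]) (auto intro!: arg_cong2[where f = "(*)"] prod.cong)
  then show ?thesis
    unfolding multilinear_def
    by (auto intro!: Vector_Spaces.linear.intro module_hom.intro vec.vector_space_axioms vec.module_axioms
         module_hom_axioms.intro
       simp: pure_tensor_def vec_eq_iff algebra_simps Vector_Spaces.linear_def)
qed

lemma multilinear_eqI:
  fixes f g :: "('d::finite \<Rightarrow> 'a::field ^ 'n::finite) \<Rightarrow> 'b::ab_group_add"
  assumes f: "multilinear scl f" and g: "multilinear scl g"
    and basis: "\<And>idx. f (\<lambda>j. axis (idx j) 1) = g (\<lambda>j. axis (idx j) 1)"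
  shows "f v = g v"
proof -
  have "f v = g v" if "\<forall>j. j \<notin> S \<longrightarrow> (\<exists>i. v j = axis i 1)" for S v
    using finite[of S] that
  proof (induction S arbitrary: v rule: finite_induct)
    case empty
    then obtain idx where "v = (\<lambda>j. axis (idx j) 1)" by (metis empty_iff ext)
    then show ?case using basis by simp
  next
    case (insert j S)
    have lin: "h v = (\<Sum>i\<in>UNIV. scl (v j $ i) (h (v(j := axis i 1))))"
      if "multilinear scl h" for h
    proof -
      interpret L: Vector_Spaces.linear "(*s)" scl "\<lambda>x. h (v(j := x))"
        using that by (simp add: multilinear_def)
      have "h v = h (v(j := (\<Sum>i\<in>UNIV. (v j $ i) *s axis i 1)))"
        by (simp add: basis_expansion)
      then show ?thesis by (simp add: L.sum L.scale)
    qed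
    have "f (v(j := axis i 1)) = g (v(j := axis i 1))" for i
      by (rule insert.IH) (use insert.prems in auto)
    then show ?case by (simp add: lin[OF f] lin[OF g])
  qed
  from this[of UNIV] show ?thesis by simp
qed

lemma pure_tensor_universal:
  fixes f :: "('d::finite \<Rightarrow> 'a::field ^ 'n::finite) \<Rightarrow> 'b::ab_group_add"
  assumes "vector_space scl" and f: "multilinear scl f"
  shows "\<exists>!F. Vector_Spaces.linear (*s) scl F \<and> (\<forall>v. F (pure_tensor v) = f v)"
proof -
  interpret W: vector_space scl by fact
  define F where "F x = (\<Sum>idx\<in>UNIV. scl (x $ idx) (f (\<lambda>j. axis (idx j) 1)))"
    for x :: "('a, 'd, 'n) tensor"
  have linF: "Vector_Spaces.linear (*s) scl F"
    by (auto intro!: module_hom.intro vec.vector_space_axioms W.vector_space_axioms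
          vec.module_axioms W.module_axioms module_hom_axioms.intro
        simp: F_def Vector_Spaces.linear_def W.scale_left_distrib sum.distrib W.scale_sum_right)
  have F_axis: "F (axis idx 1) = f (\<lambda>j. axis (idx j) 1)" for idx
    by (simp add: F_def axis_def if_distrib[of "\<lambda>c. scl c _"] cong: if_cong)
  have "multilinear scl (\<lambda>v. F (pure_tensor v))"
    unfolding multilinear_def
    using Vector_Spaces.linear_compose
        [OF multilinear_pure_tensor[unfolded multilinear_def, rule_format] linF]
    by (simp add: o_def)
  then have Ff: "F (pure_tensor v) = f v" for v
    by (rule multilinear_eqI[OF _ f]) (simp add: pure_tensor_axis F_axis)
  show ?thesis
  proof (rule ex1I)
    show "Vector_Spaces.linear (*s) scl F \<and> (\<forall>v. F (pure_tensor v) = f v)"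
      using linF Ff by blast
  next
    fix G assume G: "Vector_Spaces.linear (*s) scl G \<and> (\<forall>v. G (pure_tensor v) = f v)"
    then interpret G: Vector_Spaces.linear "(*s)" scl G by simp
    show "G = F"
    proof
      fix x :: "('a, 'd, 'n) tensor"
      have "G x = G (\<Sum>idx\<in>UNIV. (x $ idx) *s axis idx 1)" by (simp add: basis_expansion)
      also have "\<dots> = F x"
        using G by (simp add: G.sum G.scale F_def flip: pure_tensor_axis)
      finally show "G x = F x" .
    qed
  qed
qed

lemma tensor_rank_attained:
  fixes T :: "('a::field, 'd::finite, 'n::finite) tensor"
  shows "\<exists>v :: nat \<Rightarrow> 'd \<Rightarrow> 'a ^ 'n. T = (\<Sum>i<tensor_rank T. pure_tensor (v i))"
proof -
  have scale: "\<exists>w. c *s pure_tensor u = pure_tensor w" for c :: 'a and u :: "'d \<Rightarrow> 'a ^ 'n"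
  proof -
    fix j :: 'd
    interpret L: Vector_Spaces.linear "(*s)" "(*s)" "\<lambda>x. pure_tensor (u(j := x))"
      by (rule multilinear_pure_tensor[unfolded multilinear_def, rule_format])
    show ?thesis using L.scale[of c "u j"] by (metis fun_upd_triv)
  qed
  have "\<forall>idx. \<exists>w. T $ idx *s axis idx 1 = (pure_tensor w :: ('a, 'd, 'n) tensor)"
    using scale by (simp flip: pure_tensor_axis)
  then obtain w :: "('d \<Rightarrow> 'n) \<Rightarrow> 'd \<Rightarrow> 'a ^ 'n"
    where w: "\<And>idx. T $ idx *s axis idx 1 = pure_tensor (w idx)" by metis
  obtain h :: "nat \<Rightarrow> 'd \<Rightarrow> 'n" where h: "bij_betw h {..<CARD('d \<Rightarrow> 'n)} UNIV"
    using ex_bij_betw_nat_finite[OF finite_class.finite_UNIV, where ?'a1 = "'d \<Rightarrow> 'n"]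
    by (auto simp: atLeast0LessThan)
  have "T = (\<Sum>idx\<in>UNIV. pure_tensor (w idx))"
    using basis_expansion[of T] by (simp add: w)
  also have "\<dots> = (\<Sum>i<CARD('d \<Rightarrow> 'n). pure_tensor (w (h i)))"
    by (rule sum.reindex_bij_betw[OF h, symmetric])
  finally have "\<exists>k. \<exists>v :: nat \<Rightarrow> 'd \<Rightarrow> 'a ^ 'n. T = (\<Sum>i<k. pure_tensor (v i))"
    by (intro exI[of _ "CARD('d \<Rightarrow> 'n)"] exI[of _ "\<lambda>i. w (h i)"])
  then show ?thesis unfolding tensor_rank_def by (rule LeastI_ex)
qed

end

theory Submission
  imports Defs
begin

text \<open>
  Upper bound: \<open>(e\<^sub>i + e\<^sub>j) \<otimes> (e\<^sub>i - e\<^sub>j) \<otimes> (e\<^sub>k + e\<^sub>l) \<otimes> (e\<^sub>k - e\<^sub>l)\<close> plus the same term with \<open>e\<^sub>j\<close>, \<open>e\<^sub>l\<close> negated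
  is twice \<open>(e\<^sub>i \<and> e\<^sub>j) \<otimes> (e\<^sub>k \<and> e\<^sub>l)\<close> plus twice \<open>(x\<^sub>i - x\<^sub>j) \<otimes> (x\<^sub>k - x\<^sub>l)\<close>, where \<open>x\<^sub>i = e\<^sub>i \<otimes> e\<^sub>i\<close>. Summed with
  signs over the six ordered pairings \<open>ij|kl\<close>, the first parts give \<open>2 det\<^sub>4\<close> by Laplace expansion,
  and the second parts cancel by a Pluecker relation.

  Lower bound: the twofold Koszul flattening \<open>T \<mapsto> \<Phi>(T) : V \<otimes> \<Lambda>\<^sup>2V \<otimes> V* \<rightarrow> \<Lambda>\<^sup>2V \<otimes> \<Lambda>\<^sup>3V \<otimes> V\<close> is a
  \<open>96 \<times> 96\<close> matrix that has rank at most 9 on pure tensors and is invertible for \<open>T = det\<^sub>4\<close>. By itself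
  this only yields rank at least 11, but \<open>\<Phi>(det\<^sub>4 - t)\<close> still has rank at least 91 for every pure
  tensor \<open>t = a \<otimes> b \<otimes> c \<otimes> d\<close>, so that \<open>det\<^sub>4 - t\<close> is not a sum of 10 pure tensors. If \<open>a, b, c, d\<close> are
  linearly independent, they may be taken to be the standard basis, and the kernel is computed
  explicitly. Otherwise they all lie in a hyperplane, and \<open>\<Phi>(t)\<close> is nilpotent relative to \<open>\<Phi>(det\<^sub>4)\<close>
  for a grading defined by that hyperplane, so that \<open>\<Phi>(det\<^sub>4 - t)\<close> is invertible.
\<close>

subsection \<open>A decomposition with 12 terms\<close>

lemmas ring_normalize = diff_conv_add_uminus distrib_left distrib_right
  minus_mult_left [symmetric] minus_mult_right [symmetric] minus_add_distrib minus_minus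

lemma det_4:
  "det (A::'a::comm_ring_1^4^4) =
     A$1$1 * (A$2$2 * (A$3$3 * A$4$4 - A$3$4 * A$4$3) - A$2$3 * (A$3$2 * A$4$4 - A$3$4 * A$4$2)
        + A$2$4 * (A$3$2 * A$4$3 - A$3$3 * A$4$2))
   - A$1$2 * (A$2$1 * (A$3$3 * A$4$4 - A$3$4 * A$4$3) - A$2$3 * (A$3$1 * A$4$4 - A$3$4 * A$4$1)
        + A$2$4 * (A$3$1 * A$4$3 - A$3$3 * A$4$1))
   + A$1$3 * (A$2$1 * (A$3$2 * A$4$4 - A$3$4 * A$4$2) - A$2$2 * (A$3$1 * A$4$4 - A$3$4 * A$4$1)
        + A$2$4 * (A$3$1 * A$4$2 - A$3$2 * A$4$1))
   - A$1$4 * (A$2$1 * (A$3$2 * A$4$3 - A$3$3 * A$4$2) - A$2$2 * (A$3$1 * A$4$3 - A$3$3 * A$4$1)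
        + A$2$3 * (A$3$1 * A$4$2 - A$3$2 * A$4$1))"
proof -
  have f1: "finite {2::4, 3, 4}" "1 \<notin> {2::4, 3, 4}" by auto
  have f2: "finite {3::4, 4}" "2 \<notin> {3::4, 4}" by auto
  have f3: "finite {4::4}" "3 \<notin> {4::4}" by auto
  show ?thesis
    unfolding det_def UNIV_4
    unfolding sum_over_permutations_insert[OF f1] sum_over_permutations_insert[OF f2]
      sum_over_permutations_insert[OF f3] permutes_sing
    by (simp add: sign_swap_id permutation_swap_id permutation_compose sign_compose swap_id_eq,
        simp only: ring_normalize ac_simps)
qed

lemma det_tensor_nth:
  "(det_tensor :: ('a::field, 'n, 'n::finite) tensor) $ idx = det (\<chi> j. axis (idx j) 1)"
  by (auto simp: det_tensor_def pure_tensor_def det_def axis_def intro!: sum.cong prod.cong)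

text \<open>Pairing with the rows of \<open>A\<close> is a linear form \<open>F\<close> that takes
  \<open>det_tensor\<close> to \<open>det A\<close> and a pure tensor to a product over its
  factors.\<close>

lemma det_eq_sum_if_det_tensor_eq:
  fixes v :: "nat \<Rightarrow> 'n::finite \<Rightarrow> 'a::field ^ 'n"
  assumes "det_tensor = (\<Sum>i<r. pure_tensor (v i))"
  shows "det A = (\<Sum>i<r. \<Prod>j\<in>UNIV. \<Sum>p\<in>UNIV. A $ j $ p * v i j $ p)"
proof -
  define F where "F T = (\<Sum>idx\<in>UNIV. T $ idx * (\<Prod>j\<in>UNIV. A $ j $ idx j))"
    for T :: "('a, 'n, 'n) tensor"
  have F_sum: "F (sum T S) = (\<Sum>i\<in>S. F (T i))" for T :: "'b \<Rightarrow> ('a, 'n, 'n) tensor" and S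
    unfolding F_def by (simp add: sum_distrib_right) (rule sum.swap)
  have F_pure: "F (pure_tensor u) = (\<Prod>j\<in>UNIV. \<Sum>p\<in>UNIV. A $ j $ p * u j $ p)" for u
    by (simp add: prod_sum_PiE PiE_UNIV_domain F_def pure_tensor_def mult.commute flip: prod.distrib)
  have "F (c *s pure_tensor (\<lambda>i. axis (\<sigma> i) 1)) = c * (\<Prod>j\<in>UNIV. A $ j $ \<sigma> j)" for c \<sigma>
    unfolding pure_tensor_axis F_def by (simp add: axis_def if_distrib[of "\<lambda>x. c * x * _"] cong: if_cong)
  then have "F det_tensor = det A"
    unfolding det_tensor_def F_sum det_def by simp
  then show ?thesis by (simp add: assms F_sum F_pure)
qed

lemma twice_det_4:
  fixes a b c d :: "4 \<Rightarrow> 'a::comm_ring_1"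
  defines "P \<equiv> \<lambda>i j k l e. (a i + e * a j) * (b i - e * b j) * ((c k + e * c l) * (d k - e * d l))"
  defines "Q \<equiv> \<lambda>i j k l. P i j k l 1 + P i j k l (-1)"
  shows "2 * det (\<chi> j m. (if j = 1 then a else if j = 2 then b else if j = 3 then c else d) m :: 'a ^ 4 ^ 4) =
     Q 1 2 3 4 + Q 3 4 1 2 - Q 1 3 2 4 - Q 2 4 1 3 + Q 1 4 2 3 + Q 2 3 1 4"
proof -
  \<comment> \<open>For \<open>e = 1\<close> and \<open>e = -1\<close>,
    \<open>(a i + e * a j) * (b i - e * b j) = X i - X j - e * D i j\<close>; summing over both
    signs cancels the mixed terms.\<close>
  define X Y where "X i = a i * b i" and "Y i = c i * d i" for i
  define D E where "D i j = a i * b j - a j * b i" and "E i j = c i * d j - c j * d i" for i j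
  have "(X i - X j - D i j) * (Y k - Y l - E k l) + (X i - X j + D i j) * (Y k - Y l + E k l)
      = 2 * ((X i - X j) * (Y k - Y l)) + 2 * (D i j * E k l)" for i j k l
    by (simp add: algebra_simps)
  then have Q: "Q i j k l = 2 * ((X i - X j) * (Y k - Y l)) + 2 * (D i j * E k l)" for i j k l
    by (simp add: P_def Q_def X_def Y_def D_def E_def algebra_simps)
  \<comment> \<open>This is the Laplace expansion of the determinant with rows \<open>X\<close>,
    \<open>1\<close>, \<open>Y\<close>, \<open>1\<close>, two of which agree.\<close>
  have "(X 1 - X 2) * (Y 3 - Y 4) + (X 3 - X 4) * (Y 1 - Y 2) - (X 1 - X 3) * (Y 2 - Y 4)
      - (X 2 - X 4) * (Y 1 - Y 3) + (X 1 - X 4) * (Y 2 - Y 3) + (X 2 - X 3) * (Y 1 - Y 4) = 0" (is "?plucker = 0")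
    by (simp add: algebra_simps)
  moreover have "det (\<chi> j m. (if j = 1 then a else if j = 2 then b else if j = 3 then c else d) m :: 'a ^ 4 ^ 4) =
      D 1 2 * E 3 4 + D 3 4 * E 1 2 - D 1 3 * E 2 4 - D 2 4 * E 1 3 + D 1 4 * E 2 3 + D 2 3 * E 1 4" (is "_ = ?laplace")
    unfolding det_4 D_def E_def by (simp, simp only: ring_normalize ac_simps)
  moreover have "Q 1 2 3 4 + Q 3 4 1 2 - Q 1 3 2 4 - Q 2 4 1 3 + Q 1 4 2 3 + Q 2 3 1 4 = 2 * ?plucker + 2 * ?laplace"
    unfolding Q by (simp only: ring_normalize ac_simps)
  ultimately show ?thesis by simp
qed

lemma two_neq_zero:
  assumes "CHAR('a::field) \<noteq> 2"
  shows "(2::'a) \<noteq> 0"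
  using assms of_nat_eq_0_iff_char_dvd[of 2, where ?'a = 'a] CHAR_not_1'
  by (metis of_nat_numeral primes_dvd_imp_eq two_is_prime_nat prime_CHAR_semidom dvd_0_left_iff gr0I zero_neq_numeral)

lemma prod_4: "prod f (UNIV :: 4 set) = f 1 * f 2 * f 3 * f 4"
  unfolding UNIV_4 by (simp add: ac_simps)

lemma det_tensor_4_decomposition:
  assumes "CHAR('a::field) \<noteq> 2"
  shows "\<exists>v :: nat \<Rightarrow> 4 \<Rightarrow> 'a ^ 4. det_tensor = (\<Sum>i<12. pure_tensor (v i))"
proof -
  note two = two_neq_zero[OF assms]
  \<comment> \<open>The first factor carries the sign \<open>s\<close> of the pairing and the 1/2
    that undoes the doubling in \<open>twice_det_4\<close>.\<close>
  define f :: "4 \<times> 4 \<times> 4 \<times> 4 \<times> 'a \<times> 'a \<Rightarrow> 4 \<Rightarrow> 'a ^ 4" where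
    "f = (\<lambda>(i, j, k, l, s, e) m.
       if m = 1 then (s / 2) *s (axis i 1 + e *s axis j 1) else if m = 2 then axis i 1 - e *s axis j 1
       else if m = 3 then axis k 1 + e *s axis l 1 else axis k 1 - e *s axis l 1)"
  define ts :: "(4 \<times> 4 \<times> 4 \<times> 4 \<times> 'a \<times> 'a) list" where
    "ts = concat (map (\<lambda>(i, j, k, l, s). [(i, j, k, l, s, 1), (i, j, k, l, s, -1)])
    [(1, 2, 3, 4, 1), (3, 4, 1, 2, 1), (1, 3, 2, 4, -1), (2, 4, 1, 3, -1), (1, 4, 2, 3, 1), (2, 3, 1, 4, 1)])"
  have "det_tensor $ idx = (\<Sum>t\<leftarrow>ts. pure_tensor (f t) $ idx)" for idx
  proof -
    define a where "a j m = (axis (idx j) 1 :: 'a ^ 4) $ m" for j m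
    have f: "2 * pure_tensor (f (i, j, k, l, s, e)) $ idx = s * ((a 1 i + e * a 1 j) * (a 2 i - e * a 2 j)
        * ((a 3 k + e * a 3 l) * (a 4 k - e * a 4 l)))" for i j k l s e
    proof -
      have "axis m 1 $ idx j = a j m" for j m
        by (auto simp: a_def axis_def)
      then show ?thesis
        by (simp add: f_def pure_tensor_def prod_4 two mult.assoc, simp add: distrib_left)
    qed
    have "(\<chi> j. axis (idx j) 1) =
        (\<chi> j m. (if j = 1 then a 1 else if j = 2 then a 2 else if j = 3 then a 3 else a 4) m)"
      by (simp add: vec_eq_iff forall_4 a_def)
    then have "2 * det_tensor $ idx = 2 * (\<Sum>t\<leftarrow>ts. pure_tensor (f t) $ idx)"
      unfolding det_tensor_nth by (simp add: twice_det_4 ts_def f distrib_left del: distrib_left_numeral)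
    then show ?thesis using two by simp
  qed
  then have "det_tensor = (\<Sum>t\<leftarrow>ts. pure_tensor (f t))"
    by (simp add: vec_eq_iff ts_def)
  also have "\<dots> = (\<Sum>i<12. pure_tensor (f (ts ! i)))"
  proof -
    have "length ts = 12" by (simp add: ts_def)
    then show ?thesis by (simp add: sum_list_sum_nth atLeast0LessThan)
  qed
  finally show ?thesis by (rule exI[of _ "\<lambda>i. f (ts ! i)"])
qed

subsection \<open>The Koszul flattening of the determinant\<close>

text \<open>The Levi-Civita symbol, written as a determinant so that its symmetries come from those
  of the rows.\<close>

definition eps4 :: "4 \<Rightarrow> 4 \<Rightarrow> 4 \<Rightarrow> 4 \<Rightarrow> 'a::field" where
  "eps4 p q r s = det (\<chi> m. axis (if m = 1 then p else if m = 2 then q else if m = 3 then r else s) 1 :: 'a ^ 4 ^ 4)"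

lemma eps4_swap:
  "eps4 q p r s = - (eps4 p q r s :: 'a::field)" "eps4 p r q s = - (eps4 p q r s :: 'a)" "eps4 p q s r = - (eps4 p q r s :: 'a)"
proof -
  have swap: "det (\<chi> m. A $ Transposition.transpose a b m) = - det A" if "a \<noteq> b" for A :: "'a ^ 4 ^ 4" and a b
    using det_permute_rows[OF permutes_swap_id[of a UNIV b], of A] that by (simp add: sign_swap_id)
  let ?A = "\<chi> m. axis (if m = 1 then p else if m = 2 then q else if m = 3 then r else s) 1 :: 'a ^ 4 ^ 4"
  show "eps4 q p r s = - (eps4 p q r s :: 'a)"
    unfolding eps4_def swap[of 1 2 ?A, symmetric, simplified]
    by (intro arg_cong[of _ _ det]) (simp add: vec_eq_iff[of _ "\<chi> m. _ m"] forall_4 Transposition.transpose_def)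
  show "eps4 p r q s = - (eps4 p q r s :: 'a)"
    unfolding eps4_def swap[of 2 3 ?A, symmetric, simplified]
    by (intro arg_cong[of _ _ det]) (simp add: vec_eq_iff[of _ "\<chi> m. _ m"] forall_4 Transposition.transpose_def)
  show "eps4 p q s r = - (eps4 p q r s :: 'a)"
    unfolding eps4_def swap[of 3 4 ?A, symmetric, simplified]
    by (intro arg_cong[of _ _ det]) (simp add: vec_eq_iff[of _ "\<chi> m. _ m"] forall_4 Transposition.transpose_def)
qed

lemma eps4_eq [simp]:
  "eps4 p p r s = 0" "eps4 p q p s = 0" "eps4 p q r p = 0" "eps4 p q q s = 0" "eps4 p q r q = 0" "eps4 p q r r = 0"
  unfolding eps4_def
  by (rule det_identical_rows[of 1 2] det_identical_rows[of 1 3] det_identical_rows[of 1 4]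
      det_identical_rows[of 2 3] det_identical_rows[of 2 4] det_identical_rows[of 3 4]; simp add: row_def; fail)+

lemma eps4_1234: "eps4 1 2 3 4 = 1"
  unfolding eps4_def det_4 by (simp add: axis_def)

lemma eps4_distinct:
  assumes "distinct [i, j, k, l]"
  shows "eps4 i j k l \<noteq> (0 :: 'a::field)"
proof -
  define \<pi> where "\<pi> m = (if m = 1 then i else if m = 2 then j else if m = 3 then k else l)" for m :: 4
  have "inj \<pi>"
    using assms by (auto simp: inj_def forall_4 \<pi>_def)
  then have "\<pi> permutes UNIV"
    by (intro bij_imp_permutes) (simp_all add: bij_betw_def finite_UNIV_inj_surj)
  from det_permute_rows[OF this, of "mat 1 :: 'a ^ 4 ^ 4"]
  have "det (\<chi> m. mat 1 $ \<pi> m :: 'a ^ 4 ^ 4) = of_int (sign \<pi>)" by (simp add: det_I)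
  moreover have "(\<chi> m. mat 1 $ \<pi> m) = (\<chi> m. axis (\<pi> m) 1 :: 'a ^ 4 ^ 4)"
    by (simp add: vec_eq_iff mat_def axis_def eq_commute)
  ultimately show ?thesis by (simp add: eps4_def \<pi>_def sign_def)
qed

lemma sum_distinct_4:
  assumes "distinct [i, j, k, l]"
  shows "sum f (UNIV :: 4 set) = f i + f j + f k + f l"
proof -
  have "card {i, j, k, l} = CARD(4)" using assms by simp
  then have "UNIV = {i, j, k, l}" by (metis card_subset_eq finite subset_UNIV)
  then have "sum f UNIV = sum f {i, j, k, l}" by simp
  then show ?thesis using assms by (simp add: add.assoc)
qed

text \<open>
  Since \<open>\<Lambda>\<^sup>2V\<close> is dual to itself, \<open>\<Phi>(T)\<close> is applied here to \<open>w \<in> V \<otimes> \<Lambda>\<^sup>2V* \<otimes> V*\<close>, with indices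
  \<open>w x q l k\<close> alternating in \<open>q, l\<close>.
\<close>

definition contr :: "(4 \<Rightarrow> 4 \<Rightarrow> 4 \<Rightarrow> 4 \<Rightarrow> 'a) \<Rightarrow> (4 \<Rightarrow> 4 \<Rightarrow> 4 \<Rightarrow> 4 \<Rightarrow> 'a) \<Rightarrow> 4 \<Rightarrow> 4 \<Rightarrow> 4 \<Rightarrow> 4 \<Rightarrow> 'a::field" where
  "contr T w j j' l s = (\<Sum>q\<in>UNIV. \<Sum>k\<in>UNIV. T j q k s * w j' q l k - T j' q k s * w j q l k)"

definition alt :: "(4 \<Rightarrow> 4 \<Rightarrow> 4 \<Rightarrow> 4 \<Rightarrow> 'a::field) \<Rightarrow> bool" where
  "alt w \<longleftrightarrow> (\<forall>x q k. w x q q k = 0) \<and> (\<forall>x q l k. w x l q k = - w x q l k)"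

text \<open>A summand survives only if the four arguments of \<open>eps4\<close> differ. For last
  index \<open>j\<close> only the first half of \<open>contr\<close> contributes; for last index
  \<open>l\<close>, outside \<open>i\<close> and \<open>j\<close>, both halves do.\<close>

lemma contr_eps4:
  assumes "alt w" "distinct [i, j, k, l]"
  shows "contr eps4 w i j z j = eps4 i j k l * (w j k z l - w j l z k)"
    and "contr eps4 w i j z l = eps4 i j k l * (w j j z k - w j k z j + (w i i z k - w i k z i))"
proof -
  note sum = sum_distinct_4[OF assms(2)]
  have eps: "eps4 i k j l = - eps4 i j k l" "eps4 i k l j = eps4 i j k l" "eps4 i l k j = - eps4 i j k l"
    "eps4 j i k l = - eps4 i j k l" "eps4 j k i l = eps4 i j k l"
    by (simp_all only: eps4_swap(2)[of i k j l] eps4_swap(3)[of i k l j] eps4_swap(2)[of i l k j]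
        eps4_swap(1)[of j i k l] eps4_swap(2)[of j k i l] minus_minus)
  show "contr eps4 w i j z j = eps4 i j k l * (w j k z l - w j l z k)"
    by (simp add: contr_def sum eps algebra_simps)
  show "contr eps4 w i j z l = eps4 i j k l * (w j j z k - w j k z j + (w i i z k - w i k z i))"
    by (simp add: contr_def sum eps algebra_simps)
qed

text \<open>Used to show \<open>w = 0\<close>: alternation in the second and third index recovers
  \<open>2 * w\<close> from the differences under exchanging the second and fourth.\<close>

lemma twice_alt:
  assumes "alt w"
  shows "2 * w x k z l = (w x k z l - w x l z k) - (w x z l k - w x k l z) + (w x l k z - w x z k l)"
proof -
  have "w x z l k = - w x l z k" "w x k l z = - w x l k z" "w x z k l = - w x k z l"
    using assms unfolding alt_def by blast+
  then show ?thesis by simp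
qed

lemma obtain_distinct_4:
  fixes j k :: 4
  assumes "j \<noteq> k"
  obtains i l where "distinct [i, j, k, l]"
proof -
  have "card (UNIV - {j, k}) = 2" using assms by (simp add: card_Diff_subset)
  then obtain i l where "UNIV - {j, k} = {i, l}" "i \<noteq> l" by (meson card_2_iff)
  then have "i \<notin> {j, k}" "l \<notin> {j, k}" by blast+
  then show thesis using that[of i l] \<open>i \<noteq> l\<close> assms by auto
qed

text \<open>The equations force symmetry in the second and fourth index, and then all differences in
  \<open>twice_alt\<close> vanish.\<close>

lemma eq_0_if_contr_eps4_eq_0:
  assumes two: "(2::'a::field) \<noteq> 0" and w: "alt (w :: _ \<Rightarrow> _ \<Rightarrow> _ \<Rightarrow> _ \<Rightarrow> 'a)"
    and 0: "\<And>j j' l s. contr eps4 w j j' l s = 0"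
  shows "w = (\<lambda>x q l k. 0)"
proof -
  have 1: "w j k z l = w j l z k" if "distinct [i, j, k, l]" for i j k l z
    using contr_eps4(1)[OF w that, of z] eps4_distinct[OF that, where ?'a = 'a] by (simp add: 0)
  have 2: "w j j z k - w j k z j + (w i i z k - w i k z i) = 0" if "distinct [i, j, k, l]" for i j k l z
    using contr_eps4(2)[OF w that, of z] eps4_distinct[OF that, where ?'a = 'a] by (simp add: 0)
  have 3: "w j j z k = w j k z j" if "j \<noteq> k" for j k z
  proof -
    obtain i l where "distinct [i, j, k, l]" using \<open>j \<noteq> k\<close> by (rule obtain_distinct_4)
    then have "distinct [l, j, k, i]" "distinct [i, l, k, j]" by auto
    \<comment> \<open>For fixed \<open>k\<close> and \<open>z\<close>, the three values
      \<open>g m\<close> with \<open>m \<noteq> k\<close> have pairwise sums zero.\<close>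
    define g where "g m = w m m z k - w m k z m" for m
    have "g j + g i = 0" "g j + g l = 0" "g l + g i = 0"
      using 2 \<open>distinct [i, j, k, l]\<close> \<open>distinct [l, j, k, i]\<close> \<open>distinct [i, l, k, j]\<close>
      unfolding g_def by blast+
    moreover have "2 * g j = (g j + g i) + (g j + g l) - (g l + g i)" by simp
    ultimately have "2 * (w j j z k - w j k z j) = 0" by (simp add: g_def)
    with two show ?thesis by simp
  qed
  have 4: "w j k z l = w j l z k" for j k l z
  proof (cases "j \<noteq> k \<and> j \<noteq> l \<and> k \<noteq> l")
    case True
    then obtain i i' where "distinct [i, j, k, i']" using obtain_distinct_4 by blast
    then have "distinct [i, j, k, l] \<or> distinct [i', j, k, l]" using True by auto
    then show ?thesis using 1 by blast
  qed (metis 3)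
  have "2 * w x q l k = 0" for x q l k
    by (subst twice_alt[OF w]) (use 4 in simp)
  then show ?thesis using two by (simp add: fun_eq_iff)
qed

subsection \<open>Pure tensors have rank at most 9\<close>

text \<open>Gaussian elimination by induction on the equations: equation \<open>i\<close> is solved
  for an unknown \<open>u p\<close> with nonzero coefficient, and \<open>c'\<close> is the system
  left for the other unknowns.\<close>

lemma exists_nontrivial_combination:
  fixes c :: "'i \<Rightarrow> 'j \<Rightarrow> 'a::field"
  assumes "finite I" "finite J" "card I < card J"
  shows "\<exists>u. (\<exists>j\<in>J. u j \<noteq> 0) \<and> (\<forall>i\<in>I. (\<Sum>j\<in>J. c i j * u j) = 0)"
  using assms
proof (induction I arbitrary: J c rule: finite_induct)
  case empty
  then obtain j where "j \<in> J" by fastforce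
  then show ?case by (intro exI[of _ "\<lambda>_. 1"]) auto
next
  case (insert i I)
  show ?case
  proof (cases "\<forall>j\<in>J. c i j = 0")
    case True
    with insert.IH[of J c] insert.prems insert.hyps show ?thesis by auto
  next
    case False
    then obtain p where p: "p \<in> J" "c i p \<noteq> 0" by blast
    define c' where "c' k j = c k j - c k p * c i j / c i p" for k j
    have "card I < card (J - {p})"
      using insert.prems insert.hyps p by (simp add: card_Diff_singleton)
    then obtain u where u: "\<exists>j\<in>J - {p}. u j \<noteq> 0" "\<And>k. k \<in> I \<Longrightarrow> (\<Sum>j\<in>J - {p}. c' k j * u j) = 0"
      using insert.IH[of "J - {p}" c'] insert.prems by blast
    define S where "S k = (\<Sum>j\<in>J - {p}. c k j * u j)" for k
    define u' where "u' = u(p := - S i / c i p)"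
    have sum_u': "(\<Sum>j\<in>J. c k j * u' j) = S k - c k p * S i / c i p" for k
      unfolding sum.remove[OF insert.prems(1) p(1)] by (simp add: u'_def S_def)
    have "S k - c k p * S i / c i p = (\<Sum>j\<in>J - {p}. c' k j * u j)" for k
      unfolding S_def c'_def
      by (simp add: left_diff_distrib sum_subtractf sum_distrib_left sum_divide_distrib mult.assoc)
    then have "(\<Sum>j\<in>J. c k j * u' j) = 0" if "k \<in> insert i I" for k
      using that u(2)[of k] p(2) sum_u'[of k] by (cases "k = i") auto
    moreover have "\<exists>j\<in>J. u' j \<noteq> 0" using u(1) by (auto simp: u'_def)
    ultimately show ?thesis by blast
  qed
qed

lemma exists_common_zero:
  fixes L :: "'i \<Rightarrow> ('j \<Rightarrow> 'a::field) \<Rightarrow> 'a"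
  assumes "finite I" "finite J" "card I < card J"
    and add: "\<And>i u v. i \<in> I \<Longrightarrow> L i (\<lambda>j. u j + v j) = L i u + L i v"
    and scale: "\<And>i c u. i \<in> I \<Longrightarrow> L i (\<lambda>j. c * u j) = c * L i u"
  shows "\<exists>u. (\<exists>j\<in>J. u j \<noteq> 0) \<and> (\<forall>j. j \<notin> J \<longrightarrow> u j = 0) \<and> (\<forall>i\<in>I. L i u = 0)"
proof -
  define e :: "'j \<Rightarrow> 'j \<Rightarrow> 'a" where "e j k = (if k = j then 1 else 0)" for j k
  have L_sum: "L i (\<lambda>k. \<Sum>j\<in>S. u j * e j k) = (\<Sum>j\<in>S. L i (e j) * u j)" if "i \<in> I" "finite S" for i u S
    using that(2)
  proof (induction S rule: finite_induct)
    case empty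
    then show ?case using scale[OF that(1), of 0] by simp
  next
    case (insert j S)
    then show ?case
      using add[OF that(1), of "\<lambda>k. u j * e j k"] scale[OF that(1), of "u j" "e j"] by (simp add: mult.commute)
  qed
  obtain u where u: "\<exists>j\<in>J. u j \<noteq> 0" "\<And>i. i \<in> I \<Longrightarrow> (\<Sum>j\<in>J. L i (e j) * u j) = 0"
    using exists_nontrivial_combination[OF assms(1-3), of "\<lambda>i j. L i (e j)"] by blast
  define v where "v k = (\<Sum>j\<in>J. u j * e j k)" for k
  have v: "v k = (if k \<in> J then u k else 0)" for k
    using \<open>finite J\<close> by (simp add: v_def e_def if_distrib cong: if_cong)
  show ?thesis
    using u L_sum[OF _ \<open>finite J\<close>, of _ u, folded v_def[abs_def]] by (intro exI[of _ v]) (simp add: v)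
qed

text \<open>The part of \<open>w\<close> through which the flattening of a pure tensor with second
  and third factors \<open>b\<close> and \<open>c\<close> factors.\<close>

definition contr2 :: "(4 \<Rightarrow> 'a) \<Rightarrow> (4 \<Rightarrow> 'a) \<Rightarrow> (4 \<Rightarrow> 4 \<Rightarrow> 4 \<Rightarrow> 4 \<Rightarrow> 'a::field) \<Rightarrow> 4 \<Rightarrow> 4 \<Rightarrow> 'a" where
  "contr2 b c w x l = (\<Sum>q\<in>UNIV. \<Sum>k\<in>UNIV. b q * c k * w x q l k)"

lemma contr_pure:
  "contr (\<lambda>p q r s. a p * b q * c r * d s) w j j' l s =
     d s * (a j * contr2 b c w j' l - a j' * contr2 b c w j l)"
  by (simp add: contr_def contr2_def sum_distrib_left sum_subtractf right_diff_distrib ac_simps)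

lemma sum_alt_eq_0:
  fixes f :: "4 \<Rightarrow> 4 \<Rightarrow> 'a::ab_group_add"
  assumes "\<And>q. f q q = 0" "\<And>q l. f l q = - f q l"
  shows "(\<Sum>l\<in>UNIV. \<Sum>q\<in>UNIV. f q l) = 0"
  by (simp add: sum_4 assms(1) assms(2)[of 1 2] assms(2)[of 1 3] assms(2)[of 1 4] assms(2)[of 2 3]
      assms(2)[of 2 4] assms(2)[of 3 4])

lemma contr2_alt:
  assumes "alt w"
  shows "(\<Sum>l\<in>UNIV. b l * contr2 b c w x l) = 0"
proof -
  define f where "f q l = (\<Sum>k\<in>UNIV. b q * b l * c k * w x q l k)" for q l
  have w: "w x q q k = 0" "w x l q k = - w x q l k" for q l k
    using assms unfolding alt_def by blast+
  have "f q q = 0" for q by (simp add: f_def w(1))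
  moreover have "f l q = - f q l" for q l
    by (simp add: f_def w(2)[of l q] sum_negf ac_simps)
  ultimately have "(\<Sum>l\<in>UNIV. \<Sum>q\<in>UNIV. f q l) = 0"
    by (rule sum_alt_eq_0)
  then show ?thesis
    by (simp add: contr2_def f_def sum_distrib_left ac_simps)
qed

text \<open>Why nine equations suffice: column \<open>l = q\<close> follows from the others by
  \<open>contr2_alt\<close> and \<open>b q \<noteq> 0\<close>, row \<open>x = p\<close> is trivial,
  and since \<open>a p \<noteq> 0\<close> it is enough to compare all rows with row
  \<open>p\<close>.\<close>

lemma contr_pure_eq_0:
  assumes "alt w" and ab: "a p \<noteq> 0" "b q \<noteq> 0"
    and 0: "\<And>x l. x \<noteq> p \<Longrightarrow> l \<noteq> q \<Longrightarrow> a p * contr2 b c w x l = a x * contr2 b c w p l"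
  shows "contr (\<lambda>p q r s. a p * b q * c r * d s) w j j' l s = 0"
proof -
  let ?B = "contr2 b c w"
  have *: "a p * ?B x l = a x * ?B p l" for x l
  proof (cases "l = q")
    case True
    have "b q * ?B x q = - (\<Sum>l\<in>UNIV - {q}. b l * ?B x l)" for x
      using contr2_alt[OF assms(1), of b c x] by (simp add: sum.remove[of UNIV q] add_eq_0_iff2)
    moreover have "(\<Sum>l\<in>UNIV - {q}. a p * (b l * ?B x l)) = (\<Sum>l\<in>UNIV - {q}. a x * (b l * ?B p l))"
      using 0[of x] by (intro sum.cong) (cases "x = p"; auto simp: mult.left_commute)+
    ultimately have "a p * (b q * ?B x q) = a x * (b q * ?B p q)"
      by (simp add: sum_distrib_left)
    then show ?thesis using ab True by (simp add: mult.left_commute)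
  next
    case False
    then show ?thesis using 0 by (cases "x = p") auto
  qed
  have "a p * (a j * ?B j' l) = a p * (a j' * ?B j l)"
    using *[of j' l] *[of j l] by (simp add: mult.left_commute)
  then show ?thesis using ab by (simp add: contr_pure)
qed

text \<open>Dimension count: the alternating \<open>w\<close> form a space of dimension
  \<open>4 * 6 * 4 = 96\<close>, the ten pure tensors impose \<open>10 * 9 = 90\<close> equations,
  and \<open>K\<close> at most 5 more. The equations do not involve the fourth factors, hence the
  quantifier over \<open>d\<close>.\<close>

lemma exists_alt_in_kernels:
  fixes a b c :: "nat \<Rightarrow> 4 \<Rightarrow> 'a::field" and K :: "(4 \<times> 4 \<times> 4 \<times> 4) set"
  assumes "card K \<le> 5"
  shows "\<exists>w. alt w \<and> (\<exists>x q l k. w x q l k \<noteq> 0) \<and> (\<forall>(x, q, l, k)\<in>K. w x q l k = 0) \<and>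
     (\<forall>i<10. \<forall>d j j' l s. contr (\<lambda>p q r s. a i p * b i q * c i r * d s) w j j' l s = 0)"
proof -
  define P :: "(4 \<times> 4) set" where "P = {(1, 2), (1, 3), (1, 4), (2, 3), (2, 4), (3, 4)}"
  define J where "J = (UNIV :: 4 set) \<times> P \<times> (UNIV :: 4 set)"
  \<comment> \<open>\<open>P\<close> lists each pair of distinct indices in one order;
    \<open>W u\<close> extends coordinates there to an alternating \<open>w\<close>.\<close>
  define W where "W u x q l k = (if (q, l) \<in> P then u (x, (q, l), k)
      else if (l, q) \<in> P then - u (x, (l, q), k) else 0)" for u :: "4 \<times> (4 \<times> 4) \<times> 4 \<Rightarrow> 'a" and x q l k
  have "\<forall>q. (q, q) \<notin> P" "\<forall>q l. (q, l) \<in> P \<longrightarrow> (l, q) \<notin> P"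
    unfolding forall_4 by (simp_all add: P_def)
  then have P: "(q, q) \<notin> P" "(q, l) \<in> P \<Longrightarrow> (l, q) \<notin> P" for q l
    by blast+
  have W_alt: "alt (W u)" for u
    using P by (simp add: alt_def W_def)
  have W_add: "W (\<lambda>j. u j + v j) x q l k = W u x q l k + W v x q l k"
    and W_scale: "W (\<lambda>j. e * u j) x q l k = e * W u x q l k" for u v e x q l k
    by (simp_all add: W_def)
  have B_add: "contr2 b c (W (\<lambda>j. u j + v j)) x l = contr2 b c (W u) x l + contr2 b c (W v) x l"
    and B_scale: "contr2 b c (W (\<lambda>j. e * u j)) x l = e * contr2 b c (W u) x l" for b c u v e x l
    by (simp_all add: contr2_def W_add W_scale sum.distrib sum_distrib_left algebra_simps)
  have "\<exists>p. a i \<noteq> (\<lambda>_. 0) \<longrightarrow> a i p \<noteq> 0" for i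
    by auto
  then obtain p where p: "\<And>i. a i \<noteq> (\<lambda>_. 0) \<Longrightarrow> a i (p i) \<noteq> 0" by metis
  have "\<exists>p. b i \<noteq> (\<lambda>_. 0) \<longrightarrow> b i p \<noteq> 0" for i
    by auto
  then obtain q where q: "\<And>i. b i \<noteq> (\<lambda>_. 0) \<Longrightarrow> b i (q i) \<noteq> 0" by metis
  define I where "I = (SIGMA i:{..<10::nat}. (- {p i}) \<times> (- {q i})) <+> K"
  define L :: "(nat \<times> 4 \<times> 4) + 4 \<times> 4 \<times> 4 \<times> 4 \<Rightarrow> _ \<Rightarrow> 'a" where
    "L t u = (case t of
        Inl (i, x, l) \<Rightarrow> a i (p i) * contr2 (b i) (c i) (W u) x l - a i x * contr2 (b i) (c i) (W u) (p i) l
      | Inr (x, q, l, k) \<Rightarrow> W u x q l k)" for t u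
  have card_4: "card (- {m :: 4}) = 3" for m
    by (simp add: Compl_eq_Diff_UNIV card_Diff_singleton)
  have "card P = 6" unfolding P_def by simp
  then have "finite P" by (metis card.infinite zero_neq_numeral)
  then have J: "finite J" "card J = 96" using \<open>card P = 6\<close> by (simp_all add: J_def card_cartesian_product)
  have "card (SIGMA i:{..<10::nat}. (- {p i}) \<times> (- {q i})) = 90"
    by (simp add: card_SigmaI card_cartesian_product card_4)
  then have I: "finite I" "card I < card J"
    using assms by (simp_all add: I_def J card_Plus)
  have "L t (\<lambda>j. u j + v j) = L t u + L t v" for t u v
    by (simp add: L_def W_add B_add algebra_simps split: sum.splits prod.splits)
  moreover have "L t (\<lambda>j. e * u j) = e * L t u" for t e u
    by (simp add: L_def W_scale B_scale algebra_simps split: sum.splits prod.splits)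
  ultimately have "\<exists>u. (\<exists>j\<in>J. u j \<noteq> 0) \<and> (\<forall>j. j \<notin> J \<longrightarrow> u j = 0) \<and> (\<forall>t\<in>I. L t u = 0)"
    by (intro exists_common_zero[OF I(1) J(1) I(2)])
  then obtain u where u: "\<exists>j\<in>J. u j \<noteq> 0" "\<And>t. t \<in> I \<Longrightarrow> L t u = 0"
    by blast
  from u(1) obtain x q' l k where "(q', l) \<in> P" "u (x, (q', l), k) \<noteq> 0"
    by (auto simp: J_def)
  then have "W u x q' l k \<noteq> 0" by (simp add: W_def)
  moreover have "contr (\<lambda>p q r s. a i p * b i q * c i r * d s) (W u) j j' l s = 0" if "i < 10" for i d j j' l s
  proof (cases "a i = (\<lambda>_. 0) \<or> b i = (\<lambda>_. 0)")
    case True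
    then show ?thesis by (auto simp: contr_def)
  next
    case False
    have "L (Inl (i, x, l)) u = 0" if "x \<noteq> p i" "l \<noteq> q i" for x l
      by (rule u(2)) (use that \<open>i < 10\<close> in \<open>auto simp: I_def\<close>)
    then show ?thesis
      using False p q by (intro contr_pure_eq_0[OF W_alt, where p = "p i" and q = "q i"]) (auto simp: L_def)
  qed
  moreover have "W u x q l k = 0" if "(x, q, l, k) \<in> K" for x q l k
  proof -
    have "Inr (x, q, l, k) \<in> I" unfolding I_def using that by (rule InrI)
    from u(2)[OF this] show ?thesis by (simp add: L_def)
  qed
  ultimately show ?thesis using W_alt by (intro exI[of _ "W u"]) blast
qed

text \<open>The last assumption bounds the kernel dimension of the flattening of
  \<open>e * eps4 - T\<close> by \<open>card K\<close>, so its rank is at least 91, too large for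
  ten pure tensors. \<open>T\<close> will be the eleventh term.\<close>

lemma no_decomposition:
  fixes a b c d :: "nat \<Rightarrow> 4 \<Rightarrow> 'a::field"
  assumes "card K \<le> 5"
    and dec: "\<And>p q r s. e * eps4 p q r s = T p q r s + (\<Sum>i<10. a i p * b i q * c i r * d i s)"
    and 0: "\<And>w. alt w \<Longrightarrow> (\<And>x q l k. (x, q, l, k) \<in> K \<Longrightarrow> w x q l k = 0) \<Longrightarrow>
       (\<And>j j' l s. e * contr eps4 w j j' l s = contr T w j j' l s) \<Longrightarrow> w = (\<lambda>x q l k. 0)"
  shows False
proof -
  obtain w where w: "alt w" "\<exists>x q l k. w x q l k \<noteq> 0" "\<forall>(x, q, l, k)\<in>K. w x q l k = 0"
    "\<forall>i<10. \<forall>d j j' l s. contr (\<lambda>p q r s. a i p * b i q * c i r * d s) w j j' l s = 0"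
    using exists_alt_in_kernels[OF assms(1), of a b c] by blast
  have "e * contr eps4 w j j' l s = contr T w j j' l s + (\<Sum>i<10. contr (\<lambda>p q r s. a i p * b i q * c i r * d i s) w j j' l s)"
    for j j' l s
  proof -
    have "e * contr eps4 w j j' l s = (\<Sum>q\<in>UNIV. \<Sum>k\<in>UNIV. (e * eps4 j q k s) * w j' q l k - (e * eps4 j' q k s) * w j q l k)"
      by (simp add: contr_def sum_distrib_left right_diff_distrib ac_simps)
    also have "\<dots> = contr T w j j' l s + (\<Sum>q\<in>UNIV. \<Sum>k\<in>UNIV. \<Sum>i<10. a i j * b i q * c i k * d i s * w j' q l k - a i j' * b i q * c i k * d i s * w j q l k)"
      unfolding dec contr_def sum.distrib[symmetric]
      by (simp add: distrib_right sum_distrib_right sum_subtractf add_diff_add)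
    also have "(\<Sum>q\<in>UNIV. \<Sum>k\<in>UNIV. \<Sum>i<10. a i j * b i q * c i k * d i s * w j' q l k - a i j' * b i q * c i k * d i s * w j q l k)
       = (\<Sum>i<10. contr (\<lambda>p q r s. a i p * b i q * c i r * d i s) w j j' l s)"
      unfolding contr_def by (subst sum.swap[of _ "{..<10}"])+ (rule refl)
    finally show ?thesis .
  qed
  then have "e * contr eps4 w j j' l s = contr T w j j' l s" for j j' l s
    using w(4) by simp
  with 0[OF w(1)] w(3) have "w = (\<lambda>x q l k. 0)" by fast
  with w(2) show False by simp
qed

subsection \<open>Removing one pure tensor\<close>

text \<open>The last term lies in the hyperplane where coordinate \<open>n\<close> vanishes. In
  output degree \<open>g + 1\<close>, the kernel equation expresses \<open>contr eps4 (G g)\<close>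
  through \<open>G (g + 1)\<close>, so the parts \<open>G g\<close> vanish by descending
  induction.\<close>

lemma no_decomposition_dependent:
  fixes a b c d :: "nat \<Rightarrow> 4 \<Rightarrow> 'a::field"
  assumes two: "(2::'a) \<noteq> 0" and "e \<noteq> 0"
    and dec: "\<And>p q r s. e * eps4 p q r s = (\<Sum>i<Suc 10. a i p * b i q * c i r * d i s)"
    and 0: "a 10 n = 0" "b 10 n = 0" "c 10 n = 0" "d 10 n = 0"
  shows False
proof (rule no_decomposition[where K = "{}" and e = e and a = a and b = b and c = c and d = d])
  let ?T = "\<lambda>p q r s. a 10 p * b 10 q * c 10 r * d 10 s"
  show "e * eps4 p q r s = ?T p q r s + (\<Sum>i<10. a i p * b i q * c i r * d i s)" for p q r s
    unfolding dec sum.lessThan_Suc by (rule add.commute)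
  fix w :: "4 \<Rightarrow> 4 \<Rightarrow> 4 \<Rightarrow> 4 \<Rightarrow> 'a"
  assume w: "alt w" and eq: "\<And>j j' l s. e * contr eps4 w j j' l s = contr ?T w j j' l s"
  define \<delta> :: "4 \<Rightarrow> int" where "\<delta> m = (if m = n then 1 else 0)" for m
  \<comment> \<open>The homogeneous parts of \<open>w\<close> when the index \<open>n\<close> has weight 1 in \<open>V\<close> and -1 in \<open>V*\<close>: the
    tensor \<open>eps4\<close> and the pure tensor shift the degree by amounts that differ by one.\<close>
  define G where "G g x q l k = (if \<delta> x - \<delta> q - \<delta> l - \<delta> k = g then w x q l k else 0)" for g x q l k
  have G_alt: "alt (G g)" for g
  proof -
    have wz: "w x q q k = 0" "w x l q k = - w x q l k" for x q l k
      using w unfolding alt_def by blast+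
    have "\<delta> x - \<delta> l - \<delta> q - \<delta> k = \<delta> x - \<delta> q - \<delta> l - \<delta> k" for x q l k
      by simp
    then have "G g x l q k = - G g x q l k" for x q l k
      by (simp add: G_def wz(2)[of x l q k])
    moreover have "G g x q q k = 0" for x q k
      by (simp add: G_def wz(1))
    ultimately show ?thesis unfolding alt_def by blast
  qed
  \<comment> \<open>A nonzero entry of \<open>eps4\<close> uses the index \<open>n\<close> exactly
    once, a nonzero entry of \<open>?T\<close> never.\<close>
  have eps_n: "\<delta> p + \<delta> q + \<delta> r + \<delta> s = 1" if "eps4 p q r s \<noteq> (0::'a)" for p q r s
  proof -
    have dist: "distinct [p, q, r, s]" using that by auto
    have "sum \<delta> UNIV = 1" by (simp add: \<delta>_def)
    then show ?thesis by (simp add: sum_distinct_4[OF dist])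
  qed
  have "eps4 j q k s * G g j' q l k = (if \<delta> j + \<delta> j' - \<delta> l + \<delta> s = g + 1 then eps4 j q k s * w j' q l k else 0)"
    for g j j' q l k s
    using eps_n[of j q k s] by (cases "eps4 j q k s = (0::'a)") (auto simp: G_def)
  then have contr_eps: "contr eps4 (G g) j j' l s = (if \<delta> j + \<delta> j' - \<delta> l + \<delta> s = g + 1 then contr eps4 w j j' l s else 0)"
    for g j j' l s
    by (simp add: contr_def add.commute)
  have "?T j q k s * G g j' q l k = (if \<delta> j + \<delta> j' - \<delta> l + \<delta> s = g then ?T j q k s * w j' q l k else 0)"
    for g j j' q l k s
    using 0 by (auto simp: G_def \<delta>_def)
  then have contr_T: "contr ?T (G g) j j' l s = (if \<delta> j + \<delta> j' - \<delta> l + \<delta> s = g then contr ?T w j j' l s else 0)"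
    for g j j' l s
    by (simp add: contr_def add.commute)
  have step: "G g = (\<lambda>x q l k. 0)" if "G (g + 1) = (\<lambda>x q l k. 0)" for g
  proof -
    have "contr ?T (G (g + 1)) j j' l s = 0" for j j' l s
      unfolding that by (simp add: contr_def)
    then have "e * contr eps4 (G g) j j' l s = 0" for j j' l s
      unfolding contr_eps using contr_T[of "g + 1" j j' l s] eq[of j j' l s] by (auto split: if_splits)
    then show ?thesis
      using eq_0_if_contr_eps4_eq_0[OF two G_alt] \<open>e \<noteq> 0\<close> by simp
  qed
  have \<delta>: "0 \<le> \<delta> m" "\<delta> m \<le> 1" for m
    by (simp_all add: \<delta>_def)
  have deg: "\<delta> x - \<delta> q - \<delta> l - \<delta> k < 2" for x q l k
    using \<delta>(2)[of x] \<delta>(1)[of q] \<delta>(1)[of l] \<delta>(1)[of k] by linarith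
  have G_0: "G (2 - int m) = (\<lambda>x q l k. 0)" for m
  proof (induction m)
    case 0
    have "\<delta> x - \<delta> q - \<delta> l - \<delta> k \<noteq> 2" for x q l k
      using deg[of x q l k] by simp
    then show ?case by (simp add: G_def)
  next
    case (Suc m)
    then show ?case using step[of "2 - int (Suc m)"] by simp
  qed
  show "w = (\<lambda>x q l k. 0)"
  proof (intro ext)
    fix x q l k
    let ?g = "\<delta> x - \<delta> q - \<delta> l - \<delta> k"
    have "?g = 2 - int (nat (2 - ?g))" using deg[of x q l k] by simp
    then have "G ?g x q l k = 0" using G_0 by metis
    then show "w x q l k = 0" by (simp add: G_def)
  qed
qed simp_all

text \<open>The flattening of the last term sees only the coordinates \<open>y\<close>. Solving the
  equations for the differences \<open>H\<close> and inserting these into \<open>twice_alt\<close>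
  expresses \<open>4 * e * y\<close> through \<open>y\<close>.\<close>

lemma no_decomposition_standard:
  fixes a b c d :: "nat \<Rightarrow> 4 \<Rightarrow> 'a::field"
  assumes two: "(2::'a) \<noteq> 0" and "e \<noteq> 0"
    and dec: "\<And>p q r s. e * eps4 p q r s = (\<Sum>i<Suc 10. a i p * b i q * c i r * d i s)"
    and std: "\<And>m. a 10 m = (if m = 1 then 1 else 0)" "\<And>m. b 10 m = (if m = 2 then 1 else 0)"
      "\<And>m. c 10 m = (if m = 3 then 1 else 0)" "\<And>m. d 10 m = (if m = 4 then 1 else 0)"
  shows False
proof (rule no_decomposition[where e = e and a = a and b = b and c = c and d = d])
  let ?T = "\<lambda>p q r s. a 10 p * b 10 q * c 10 r * d 10 s"
  \<comment> \<open>A solution \<open>w\<close> is determined by nine coordinates, and \<open>4 e\<close> acts on them, up to one off-diagonal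
    entry, by eigenvalues 1, 2 and 4 of multiplicity 4, 4 and 1 (\<open>E2\<close>, \<open>E3\<close>, \<open>E4\<close> below). So at most five
    of them have to be forced to vanish, namely those with eigenvalue 2 or those without.\<close>
  let ?K = "if 4 * e = 2 then {(2, 2, 3, 3), (3, 2, 3, 3), (4, 2, 1, 3), (4, 2, 4, 3)}
    else {(2, 2, 1, 3), (2, 2, 4, 3), (3, 2, 1, 3), (3, 2, 4, 3), (4, 2, 3, 3)} :: (4 \<times> 4 \<times> 4 \<times> 4) set"
  show "card ?K \<le> 5" by simp
  show "e * eps4 p q r s = ?T p q r s + (\<Sum>i<10. a i p * b i q * c i r * d i s)" for p q r s
    unfolding dec sum.lessThan_Suc by (rule add.commute)
  fix w :: "4 \<Rightarrow> 4 \<Rightarrow> 4 \<Rightarrow> 4 \<Rightarrow> 'a"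
  assume w: "alt w" and K: "\<And>x q l k. (x, q, l, k) \<in> ?K \<Longrightarrow> w x q l k = 0"
    and eq: "\<And>j j' l s. e * contr eps4 w j j' l s = contr ?T w j j' l s"
  define y where "y x l = w x 2 l 3" for x l
  have contr_T: "contr ?T w j j' l s =
      (if s = 4 then (if j = 1 then y j' l else 0) - (if j' = 1 then y j l else 0) else 0)" for j j' l s
    by (simp add: contr_def std y_def sum_4)
  define H where "H j k z l = e * (w j k z l - w j l z k)" for j k z l
  have H_swap: "H j l z k = - H j k z l" for j k l z
    by (simp add: H_def algebra_simps)
  have H1: "eps4 i j k l * H j k z l = (if j = 4 then (if i = 1 then y 4 z else 0) else 0)"
    if "distinct [i, j, k, l]" for i j k l z
    using eq[of i j z j] that unfolding contr_T contr_eps4(1)[OF w that] H_def by (auto simp: mult.left_commute)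
  have H2: "eps4 i j k l * (H j j z k + H i i z k) =
      (if l = 4 then (if i = 1 then y j z else 0) - (if j = 1 then y i z else 0) else 0)"
    if "distinct [i, j, k, l]" for i j k l z
    using eq[of i j z l] unfolding contr_T contr_eps4(2)[OF w that] H_def by (simp add: algebra_simps)
  have "eps4 1 4 2 3 = (1::'a)" "eps4 1 3 2 4 = (-1::'a)"
    by (simp_all only: eps4_swap(2)[of 1 4 2 3] eps4_swap(3)[of 1 2 4 3] eps4_swap(2)[of 1 3 2 4]
        eps4_1234 minus_minus)
  note eps = this eps4_1234[where ?'a = 'a]
  have H4: "H 4 2 z 3 = y 4 z" for z
    using H1[of 1 4 2 3 z] by (simp add: eps)
  have H0: "H j k z l = 0" if "distinct [j, k, l]" "j \<noteq> 4 \<or> k = 1 \<or> l = 1" for j k l z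
  proof -
    have "j \<noteq> k" using that(1) by simp
    then obtain i i' where "distinct [i, j, k, i']" by (rule obtain_distinct_4)
    with that(1) have "distinct [i, j, k, l] \<or> distinct [i', j, k, l]" by auto
    then obtain i where i: "distinct [i, j, k, l]" by blast
    with that(2) have "j = 4 \<Longrightarrow> i \<noteq> 1" by auto
    with H1[OF i, of z] eps4_distinct[OF i, where ?'a = 'a] show ?thesis by (auto split: if_splits)
  qed
  have H2_0: "H j j z k + H i i z k = 0" if "distinct [i, j, k, l]" "l \<noteq> 4 \<or> i \<noteq> 1 \<and> j \<noteq> 1" for i j k l z
    using H2[OF that(1), of z] eps4_distinct[OF that(1), where ?'a = 'a] that(2) by (auto split: if_splits)
  \<comment> \<open>Solves for three diagonal values \<open>H m m z k\<close> with known pairwise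
    sums, without dividing by 2.\<close>
  have triple: "2 * p = t \<and> 2 * q = t \<and> 2 * r = - t" if "q + p = t" "r + p = 0" "r + q = 0" for p q r t :: 'a
  proof -
    have "r = - p" "r = - q" using that(2,3) by (simp_all only: eq_neg_iff_add_eq_0)
    then show ?thesis using that(1) by auto
  qed
  have k1: "H 3 3 z 1 = 0" "H 2 2 z 1 = 0" for z
    using triple[of "H 3 3 z 1" "H 2 2 z 1" 0 "H 4 4 z 1"] H2_0[of 2 3 1 4 z] H2_0[of 2 4 1 3 z] H2_0[of 3 4 1 2 z] two
    by simp_all
  have k4: "H 3 3 z 4 = 0" "H 2 2 z 4 = 0" for z
    using triple[of "H 3 3 z 4" "H 2 2 z 4" 0 "H 1 1 z 4"] H2_0[of 2 3 4 1 z] H2_0[of 2 1 4 3 z] H2_0[of 3 1 4 2 z] two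
    by simp_all
  have "- (H 3 3 z 2 + H 1 1 z 2) = y 3 z" for z
    using H2[of 1 3 2 4 z] by (simp add: eps)
  then have "H 3 3 z 2 + H 1 1 z 2 = - y 3 z" for z
    by (metis minus_minus)
  then have k2: "2 * H 3 3 z 2 = - y 3 z" "2 * H 4 4 z 2 = y 3 z" for z
    using triple[of "H 3 3 z 2" "H 1 1 z 2" "- y 3 z" "H 4 4 z 2"] H2_0[of 1 4 2 3 z] H2_0[of 3 4 2 1 z]
    by simp_all
  have "H 2 2 z 3 + H 1 1 z 3 = y 2 z" for z
    using H2[of 1 2 3 4 z] by (simp add: eps)
  then have k3: "2 * H 2 2 z 3 = y 2 z" "2 * H 4 4 z 3 = - y 2 z" for z
    using triple[of "H 2 2 z 3" "H 1 1 z 3" "y 2 z" "H 4 4 z 3"] H2_0[of 1 4 3 2 z] H2_0[of 2 4 3 1 z]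
    by simp_all
  have y2: "y x 2 = 0" for x
    using w unfolding alt_def y_def by blast
  have same: "H j k z k = 0" for j k z
    by (simp add: H_def)
  \<comment> \<open>\<open>twice_alt\<close> times \<open>2 * e\<close>, so that the values of
    \<open>H\<close> enter doubled, as \<open>k2\<close> and \<open>k3\<close> give them.\<close>
  have tw: "4 * e * y x z = 2 * H x 2 z 3 - 2 * H x z 3 2 + 2 * H x 3 2 z" for x z
  proof -
    have "4 * e * y x z = 2 * e * (2 * w x 2 z 3)" by (simp add: y_def)
    also have "\<dots> = 2 * H x 2 z 3 - 2 * H x z 3 2 + 2 * H x 3 2 z"
      unfolding twice_alt[OF w, of x 2 z 3] H_def by (simp only: ring_normalize ac_simps)
    finally show ?thesis .
  qed
  have "4 * e * y 2 1 = y 2 1" "4 * e * y 2 4 = y 2 4" "4 * e * y 2 3 = 2 * y 2 3"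
    using tw[of 2 1] tw[of 2 4] tw[of 2 3]
    by (simp_all add: H_swap[of 2 1 3 2] H_swap[of 2 4 3 2] H_swap[of 2 3 3 2] k1 k3 k4 H0 same)
  note E2 = this
  have "4 * e * y 3 1 = y 3 1" "4 * e * y 3 4 = y 3 4" "4 * e * y 3 3 = 2 * y 3 3"
    using tw[of 3 1] tw[of 3 4] tw[of 3 3]
    by (simp_all add: H_swap[of 3 2 1 3] H_swap[of 3 2 4 3] H_swap[of 3 2 3 3] k1 k2 k4 H0 same)
  note E3 = this
  have "4 * e * y 4 1 = 2 * y 4 1" "4 * e * y 4 4 = 2 * y 4 4 - y 3 3" "4 * e * y 4 3 = 4 * y 4 3"
    using tw[of 4 1] tw[of 4 4] tw[of 4 3]
    by (simp_all add: H_swap[of 4 3 2 4] H_swap[of 4 3 3 2] k2 k3 y2 H4 H0 same)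
  note E4 = this
  \<comment> \<open>In characteristic other than 2 the eigenvalue 2 differs from 1 and 4, while 1
    and 4 agree in characteristic 3; so the cases separate 2 from the rest.\<close>
  have y0: "y 2 1 = 0 \<and> y 2 4 = 0 \<and> y 2 3 = 0 \<and> y 3 1 = 0 \<and> y 3 4 = 0 \<and> y 3 3 = 0
      \<and> y 4 1 = 0 \<and> y 4 4 = 0 \<and> y 4 3 = 0"
  proof (cases "4 * e = 2")
    case True
    have double: "t = 0" if "2 * t = t" for t :: 'a
      using that by (metis mult_2 add_cancel_right_right)
    have "y 2 1 = 0" "y 2 4 = 0" "y 3 1 = 0" "y 3 4 = 0"
      using E2(1,2) E3(1,2) double unfolding True by blast+
    moreover have "4 * y 4 3 = 2 * y 4 3"
      using E4(3) unfolding True by (rule sym)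
    then have "2 * (2 * y 4 3) = 2 * y 4 3" by simp
    then have "y 4 3 = 0" using double[of "2 * y 4 3"] two by simp
    ultimately show ?thesis
      using K True by (simp add: y_def)
  next
    case False
    then have "y 2 3 = 0" "y 3 3 = 0" "y 4 1 = 0"
      using E2(3) E3(3) E4(1) by (simp_all only: mult_cancel_right) simp_all
    moreover from this have "y 4 4 = 0"
      using False E4(2) by simp
    ultimately show ?thesis
      using K False by (simp add: y_def)
  qed
  \<comment> \<open>The values \<open>y 1 l\<close> cancel in \<open>contr_T\<close>: wedging with
    the first basis vector kills them.\<close>
  have "y x l = 0" if "x \<noteq> 1" for x l
    using y0 y2[of x] exhaust_4[of x] exhaust_4[of l] that by auto
  then have "e * contr eps4 w j j' l s = 0" for j j' l s
    unfolding eq contr_T by simp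
  then show "w = (\<lambda>x q l k. 0)"
    using eq_0_if_contr_eps4_eq_0[OF two w] \<open>e \<noteq> 0\<close> by simp
qed

subsection \<open>The tensor rank\<close>

text \<open>A base change \<open>G\<close> in all factors multiplies the determinant tensor by
  \<open>det G\<close>, the scalar \<open>e\<close> of the preceding lemmas. Its entries are
  determinants of selected rows of \<open>G\<close>.\<close>

lemma det_times_eps4:
  fixes v :: "nat \<Rightarrow> 4 \<Rightarrow> 'a::field ^ 4" and G :: "'a ^ 4 ^ 4"
  assumes "det_tensor = (\<Sum>i<n. pure_tensor (v i))"
  shows "det G * eps4 p q r s =
    (\<Sum>i<n. (G *v v i 1) $ p * (G *v v i 2) $ q * (G *v v i 3) $ r * (G *v v i 4) $ s)"
proof -
  define f where "f m = (if m = 1 then p else if m = 2 then q else if m = 3 then r else s)" for m :: 4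
  define P :: "'a ^ 4 ^ 4" where "P = (\<chi> m. axis (f m) 1)"
  have "P ** G = (\<chi> m. G $ f m)"
    by (simp add: P_def matrix_matrix_mult_def vec_eq_iff axis_def if_distrib[of "\<lambda>x. x * _"] cong: if_cong)
  moreover have "det (P ** G) = det G * eps4 p q r s"
    by (simp add: det_mul P_def f_def eps4_def)
  ultimately show ?thesis
    using det_eq_sum_if_det_tensor_eq[OF assms, of "P ** G"]
    by (simp add: prod_4 f_def matrix_vector_mult_def)
qed

lemma det_tensor_4_ne_sum_11:
  fixes v :: "nat \<Rightarrow> 4 \<Rightarrow> 'a::field ^ 4"
  assumes two: "(2::'a) \<noteq> 0"
  shows "det_tensor \<noteq> (\<Sum>i<Suc 10. pure_tensor (v i))"
proof
  assume "det_tensor = (\<Sum>i<Suc 10. pure_tensor (v i))"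
  note dec = det_times_eps4[OF this]
  define B where "B = (\<chi> m. v 10 m)"
  have det_nz: "det A \<noteq> 0 \<longleftrightarrow> (\<forall>x. A *v x = 0 \<longrightarrow> x = 0)" for A :: "'a ^ 4 ^ 4"
    unfolding invertible_det_nz[symmetric] invertible_left_inverse matrix_left_invertible_ker ..
  show False
  proof (cases "det B = 0")
    case True
    \<comment> \<open>\<open>y\<close> annihilates all four factors of the last term. As row
      \<open>n\<close> of \<open>G\<close> it makes their coordinate \<open>n\<close> vanish, and
      \<open>y $ n \<noteq> 0\<close> keeps \<open>G\<close> invertible.\<close>
    then obtain y where y: "B *v y = 0" "y \<noteq> 0" using det_nz[of B] by blast
    then obtain n where n: "y $ n \<noteq> 0" by (auto simp: vec_eq_iff)
    define G :: "'a ^ 4 ^ 4" where "G = (\<chi> m. if m = n then y else axis m 1)"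
    have "x = 0" if "G *v x = 0" for x
    proof -
      have x: "(G *v x) $ m = 0" for m using that by simp
      have "x $ m = 0" if "m \<noteq> n" for m
        using x[of m] that by (simp add: G_def matrix_vector_mult_def axis_def if_distrib[of "\<lambda>x. x * _"] cong: if_cong)
      moreover from this have "(\<Sum>k\<in>UNIV. y $ k * x $ k) = y $ n * x $ n"
        by (subst sum.remove[of _ n]) simp_all
      then have "x $ n = 0"
        using x[of n] n by (simp add: G_def matrix_vector_mult_def)
      ultimately show ?thesis by (metis vec_eq_iff zero_index)
    qed
    then have "det G \<noteq> 0"
      using det_nz by blast
    moreover have "(G *v v 10 m) $ n = (B *v y) $ m" for m
      by (simp add: G_def B_def matrix_vector_mult_def mult.commute)
    then have "(G *v v 10 m) $ n = 0" for m
      by (simp add: y)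
    ultimately show False
      using no_decomposition_dependent[OF two _ dec] by blast
  next
    case False
    then have "invertible (transpose B)"
      by (simp add: invertible_det_nz det_transpose)
    \<comment> \<open>The factors are the columns of \<open>transpose B\<close>, so \<open>G\<close>
      takes them to the standard basis.\<close>
    then obtain G where G: "G ** transpose B = mat 1" by (auto simp: invertible_def)
    then have "det G \<noteq> 0"
      by (metis det_I det_mul mult_zero_left zero_neq_one)
    moreover have "(G *v v 10 m) $ p = (G ** transpose B) $ p $ m" for m p
      by (simp add: B_def matrix_vector_mult_def matrix_matrix_mult_def transpose_def)
    then have "(G *v v 10 m) $ p = (if p = m then 1 else 0)" for m p
      by (simp add: G mat_def)
    ultimately show False
      using no_decomposition_standard[OF two _ dec] by blast
  qed
qed

theorem theorem4p7:
  assumes "CHAR('a::field) \<noteq> 2"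
  shows "tensor_rank (det_tensor :: ('a, 4, 4) tensor) = 12"
proof (rule antisym)
  let ?r = "tensor_rank (det_tensor :: ('a, 4, 4) tensor)"
  show "?r \<le> 12"
    unfolding tensor_rank_def using det_tensor_4_decomposition[OF assms] by (rule Least_le)
  obtain v :: "nat \<Rightarrow> 4 \<Rightarrow> 'a ^ 4" where v: "det_tensor = (\<Sum>i<?r. pure_tensor (v i))"
    using tensor_rank_attained by blast
  show "12 \<le> ?r"
  proof (rule ccontr)
    assume "\<not> 12 \<le> ?r"
    then have r: "{..<?r} \<subseteq> {..<Suc 10}" by auto
    \<comment> \<open>Zero terms pad a shorter decomposition to exactly 11 terms.\<close>
    define u where "u i = (if i < ?r then v i else (\<lambda>_. 0))" for i
    have "pure_tensor (u i) = 0" if "\<not> i < ?r" for i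
      using that by (simp add: u_def pure_tensor_def vec_eq_iff)
    then have "(\<Sum>i<Suc 10. pure_tensor (u i)) = (\<Sum>i<?r. pure_tensor (u i))"
      using r by (intro sum.mono_neutral_right) auto
    also have "\<dots> = det_tensor"
      using v by (simp add: u_def)
    finally show False
      using det_tensor_4_ne_sum_11[OF two_neq_zero[OF assms], of u] by metis
  qed
qed

end
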